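(* Let $(S,s)$ be a finite irretractable bijective set-theoretic solution to the Pentagon Equation. Let $A=1\circ S$ (a group under $\circ$) and $G=1\cdot S$ (a group under $\cdot$), and define, for $a\in A$ and $x\in G$, $$\sigma_a(x)=1\cdot\theta_a(x)\in G,\qquad \delta_x(a)=\big(1\circ\psi_{x^{-1}}(a^{-1})\big)^{-1}\in A,$$ where $x^{-1}$ is the inverse of $x$ in $(G,\cdot)$, and $a^{-1}$ and the outer inverse are taken in $(A,\circ)$. Then $A$ and $G$ form a matched pair of groups with respect to $\sigma$ and $\delta$, and $(S,s)$ is isomorphic to the solution $(A\times G,s')$ given by $$s'((a,x),(b,y))=\big((a,x\cdot y),\ (b\circ(\delta_x(a))^{-1},\ \sigma_{\delta_x(a)}(y))\big).$$
   Context: A set-theoretic solution to the Pentagon Equation is a pair $(S,s)$ with $S$ a nonempty set and $s:S\times S\to S\times S$ a map such that $s_{23}s_{13}s_{12}=s_{12}s_{23}$ on $S\times S\times S$, where $s_{12}=s\times\mathrm{id}$, $s_{23}=\mathrm{id}\times s$, $s_{13}=(\tau\times\mathrm{id})(\mathrm{id}\times s)(\tau\times\mathrm{id})$ and $\tau(x,y)=(y,x)$. It is finite if $S$ is finite, and bijective if $s$ is bijective. Two solutions $(S,s)$, $(T,t)$ are isomorphic if there is a bijection $f:S\to T$ with $(f\times f)s=t(f\times f)$. Write $s(x,y)=(x\cdot y,\theta_x(y))$ and $s^{-1}(x,y)=(\psi_y(x),y\circ x)$. Then $(S,\cdot)$ and $(S,\circ)$ are semigroups; $E(S,\cdot)$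 and $E(S,\circ)$ denote their sets of idempotents. For a finite bijective solution both semigroups are left groups (isomorphic to $E\times H$ with $H$ a group and $(e,g)(f,h)=(e,gh)$). Fix $e_0\in E(S,\cdot)$, put $1=\theta_{e_0}(e_0)$, an idempotent of $(S,\cdot)$, and $G_1=1\cdot S$. Every element of $S$ is uniquely $e\cdot g$ with $e\in E(S,\cdot)$, $g\in G_1$. Define $e\cdot g\approx f\cdot h$ (for $e,f\in E(S,\cdot)$, $g,h\in G_1$) iff $\theta_e=\theta_f$ and $g=h$. The solution is irretractable if $\approx$ is the equality relation. For a finite irretractable bijective solution, $G=1\cdot S=E(S,\circ)$ is a subgroup of $(S,\cdot)$ and $A=1\circ S=E(S,\cdot)$ is a subgroup of $(S,\circ)$, both with identity $1$; $S$ is identified with $A\times G$ via $(a,x)=a\cdot x$, so that $(a,1)$ is $a\in A$ and $(1,x)$ is $x\in G$. A matched pair of groups consists of groups $A$ and $G$, a left action $\sigma:A\to\mathrm{Sym}(G)$ (so $\sigma_{ab}=\sigma_a\sigma_b$) and a right action $\delta:G\to\mathrm{Sym}(A)$ (so $\delta_{xy}=\delta_y\delta_x$), such that for all $a,b\in A$, $x,y\in G$: $\sigma_a(xy)=\sigma_a(x)\,\sigma_{\delta_x(a)}(y)$ and $\delta_x(ab)=\delta_{\sigma_b(x)}(a)\,\delta_x(b)$. *)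

theory Defs
  imports "HOL-Algebra.Group"
begin

section \<open>Set-theoretic solutions of the Pentagon Equation\<close>

definition pe_s12 :: "('a \<times> 'a \<Rightarrow> 'a \<times> 'a) \<Rightarrow> 'a \<times> 'a \<times> 'a \<Rightarrow> 'a \<times> 'a \<times> 'a" where
  "pe_s12 s = (\<lambda>(x, y, z). case s (x, y) of (u, v) \<Rightarrow> (u, v, z))"

definition pe_s23 :: "('a \<times> 'a \<Rightarrow> 'a \<times> 'a) \<Rightarrow> 'a \<times> 'a \<times> 'a \<Rightarrow> 'a \<times> 'a \<times> 'a" where
  "pe_s23 s = map_prod id s"

definition pe_tau12 :: "'a \<times> 'a \<times> 'a \<Rightarrow> 'a \<times> 'a \<times> 'a" where
  "pe_tau12 = (\<lambda>(x, y, z). (y, x, z))"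

definition pe_s13 :: "('a \<times> 'a \<Rightarrow> 'a \<times> 'a) \<Rightarrow> 'a \<times> 'a \<times> 'a \<Rightarrow> 'a \<times> 'a \<times> 'a" where
  "pe_s13 s = pe_tau12 \<circ> pe_s23 s \<circ> pe_tau12"

definition pe_solution :: "'a set \<Rightarrow> ('a \<times> 'a \<Rightarrow> 'a \<times> 'a) \<Rightarrow> bool" where
  "pe_solution S s \<longleftrightarrow>
     S \<noteq> {} \<and> s \<in> S \<times> S \<rightarrow> S \<times> S \<and>
     (\<forall>t \<in> S \<times> S \<times> S. (pe_s23 s \<circ> pe_s13 s \<circ> pe_s12 s) t = (pe_s12 s \<circ> pe_s23 s) t)"

definition pe_bijective :: "'a set \<Rightarrow> ('a \<times> 'a \<Rightarrow> 'a \<times> 'a) \<Rightarrow> bool" where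
  "pe_bijective S s \<longleftrightarrow> bij_betw s (S \<times> S) (S \<times> S)"

definition pe_isomorphic ::
  "'a set \<Rightarrow> ('a \<times> 'a \<Rightarrow> 'a \<times> 'a) \<Rightarrow> 'b set \<Rightarrow> ('b \<times> 'b \<Rightarrow> 'b \<times> 'b) \<Rightarrow> bool" where
  "pe_isomorphic S s T t \<longleftrightarrow>
     (\<exists>f. bij_betw f S T \<and>
          (\<forall>p \<in> S \<times> S. (map_prod f f \<circ> s) p = (t \<circ> map_prod f f) p))"

text \<open>
  We write $s(x,y) = (x \cdot y, \theta_x(y))$ and $s^{-1}(x,y) = (\psi_y(x), y \circ x)$, the inverse
  being that of \<open>s\<close> as a map on \<open>S \<times> S\<close>. Note the order of the arguments in the second formula:
  \<open>pe_psi S s y x\<close> is $\psi_y(x)$ and \<open>pe_circ S s y x\<close> is $y \circ x$, both read off from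
  $s^{-1}(x,y)$.
\<close>

definition pe_dot :: "('a \<times> 'a \<Rightarrow> 'a \<times> 'a) \<Rightarrow> 'a \<Rightarrow> 'a \<Rightarrow> 'a" where
  "pe_dot s x y = fst (s (x, y))"

definition pe_theta :: "('a \<times> 'a \<Rightarrow> 'a \<times> 'a) \<Rightarrow> 'a \<Rightarrow> 'a \<Rightarrow> 'a" where
  "pe_theta s x y = snd (s (x, y))"

definition pe_psi :: "'a set \<Rightarrow> ('a \<times> 'a \<Rightarrow> 'a \<times> 'a) \<Rightarrow> 'a \<Rightarrow> 'a \<Rightarrow> 'a" where
  "pe_psi S s y x = fst (inv_into (S \<times> S) s (x, y))"

definition pe_circ :: "'a set \<Rightarrow> ('a \<times> 'a \<Rightarrow> 'a \<times> 'a) \<Rightarrow> 'a \<Rightarrow> 'a \<Rightarrow> 'a" where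
  "pe_circ S s y x = snd (inv_into (S \<times> S) s (x, y))"

definition pe_idem :: "'a set \<Rightarrow> ('a \<times> 'a \<Rightarrow> 'a \<times> 'a) \<Rightarrow> 'a set" where
  "pe_idem S s = {e \<in> S. pe_dot s e e = e}"

text \<open>
  In the following definitions \<open>u\<close> stands for the distinguished element $1 = \theta_{e_0}(e_0)$,
  where $e_0$ is a fixed idempotent of $(S,\cdot)$. That the two structures \<open>pe_G\<close> and \<open>pe_A\<close> are
  groups (with neutral element \<open>u\<close>) is not built into their definitions.
\<close>

definition pe_G :: "'a set \<Rightarrow> ('a \<times> 'a \<Rightarrow> 'a \<times> 'a) \<Rightarrow> 'a \<Rightarrow> 'a monoid" where
  "pe_G S s u = \<lparr>carrier = pe_dot s u ` S, mult = pe_dot s, one = u\<rparr>"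

definition pe_A :: "'a set \<Rightarrow> ('a \<times> 'a \<Rightarrow> 'a \<times> 'a) \<Rightarrow> 'a \<Rightarrow> 'a monoid" where
  "pe_A S s u = \<lparr>carrier = pe_circ S s u ` S, mult = pe_circ S s, one = u\<rparr>"

definition pe_retract :: "'a set \<Rightarrow> ('a \<times> 'a \<Rightarrow> 'a \<times> 'a) \<Rightarrow> 'a \<Rightarrow> 'a \<Rightarrow> 'a \<Rightarrow> bool" where
  "pe_retract S s u p q \<longleftrightarrow>
     (\<exists>e \<in> pe_idem S s. \<exists>f \<in> pe_idem S s. \<exists>g \<in> pe_dot s u ` S. \<exists>h \<in> pe_dot s u ` S.
        p = pe_dot s e g \<and> q = pe_dot s f h \<and>
        (\<forall>y \<in> S. pe_theta s e y = pe_theta s f y) \<and> g = h)"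

definition pe_irretractable :: "'a set \<Rightarrow> ('a \<times> 'a \<Rightarrow> 'a \<times> 'a) \<Rightarrow> 'a \<Rightarrow> bool" where
  "pe_irretractable S s u \<longleftrightarrow> (\<forall>p \<in> S. \<forall>q \<in> S. pe_retract S s u p q \<longleftrightarrow> p = q)"

definition pe_sigma :: "('a \<times> 'a \<Rightarrow> 'a \<times> 'a) \<Rightarrow> 'a \<Rightarrow> 'a \<Rightarrow> 'a \<Rightarrow> 'a" where
  "pe_sigma s u a x = pe_dot s u (pe_theta s a x)"

definition pe_delta :: "'a set \<Rightarrow> ('a \<times> 'a \<Rightarrow> 'a \<times> 'a) \<Rightarrow> 'a \<Rightarrow> 'a \<Rightarrow> 'a \<Rightarrow> 'a" where
  "pe_delta S s u x a =
     inv\<^bsub>pe_A S s u\<^esub>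
       (pe_circ S s u (pe_psi S s (inv\<^bsub>pe_G S s u\<^esub> x) (inv\<^bsub>pe_A S s u\<^esub> a)))"

section \<open>Matched pairs of groups\<close>

locale matched_pair = A: group A + G: group G
  for A :: "('a, 'm) monoid_scheme" and G :: "('b, 'n) monoid_scheme" +
  fixes \<sigma> :: "'a \<Rightarrow> 'b \<Rightarrow> 'b" and \<delta> :: "'b \<Rightarrow> 'a \<Rightarrow> 'a"
  assumes sigma_bij: "a \<in> carrier A \<Longrightarrow> bij_betw (\<sigma> a) (carrier G) (carrier G)"
    and sigma_action: "\<lbrakk>a \<in> carrier A; b \<in> carrier A; x \<in> carrier G\<rbrakk>
      \<Longrightarrow> \<sigma> (a \<otimes>\<^bsub>A\<^esub> b) x = \<sigma> a (\<sigma> b x)"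
    and delta_bij: "x \<in> carrier G \<Longrightarrow> bij_betw (\<delta> x) (carrier A) (carrier A)"
    and delta_action: "\<lbrakk>x \<in> carrier G; y \<in> carrier G; a \<in> carrier A\<rbrakk>
      \<Longrightarrow> \<delta> (x \<otimes>\<^bsub>G\<^esub> y) a = \<delta> y (\<delta> x a)"
    and sigma_mult: "\<lbrakk>a \<in> carrier A; x \<in> carrier G; y \<in> carrier G\<rbrakk>
      \<Longrightarrow> \<sigma> a (x \<otimes>\<^bsub>G\<^esub> y) = \<sigma> a x \<otimes>\<^bsub>G\<^esub> \<sigma> (\<delta> x a) y"
    and delta_mult: "\<lbrakk>x \<in> carrier G; a \<in> carrier A; b \<in> carrier A\<rbrakk>
      \<Longrightarrow> \<delta> x (a \<otimes>\<^bsub>A\<^esub> b) = \<delta> (\<sigma> b x) a \<otimes>\<^bsub>A\<^esub> \<delta> x b"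

definition matched_pair_map ::
  "('a, 'm) monoid_scheme \<Rightarrow> ('b, 'n) monoid_scheme \<Rightarrow> ('a \<Rightarrow> 'b \<Rightarrow> 'b) \<Rightarrow> ('b \<Rightarrow> 'a \<Rightarrow> 'a) \<Rightarrow>
     ('a \<times> 'b) \<times> ('a \<times> 'b) \<Rightarrow> ('a \<times> 'b) \<times> ('a \<times> 'b)" where
  "matched_pair_map A G \<sigma> \<delta> =
     (\<lambda>((a, x), (b, y)).
        ((a, x \<otimes>\<^bsub>G\<^esub> y), (b \<otimes>\<^bsub>A\<^esub> inv\<^bsub>A\<^esub> (\<delta> x a), \<sigma> (\<delta> x a) y)))"

end

theory Submission
  imports Defs
begin

text \<open>
  (In the proofs \<open>\<circ>\<close> is written \<open>\<bullet>\<close>, and \<open>1\<close> is \<open>u\<close>.)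
  The pentagon equation makes \<open>\<cdot>\<close> and \<open>\<circ>\<close> semigroups, \<open>\<theta>\<close> a homomorphism from \<open>(S, \<circ>)\<close> and \<open>\<psi>\<close> one
  from \<open>(S, \<cdot>)\<close>. Since an injective self-map of a finite set is onto, every \<open>x\<close> lies in
  \<open>{x \<cdot> y} \<union> x \<cdot> y \<cdot> S\<close>; if \<open>e = p \<cdot> q\<close> is idempotent this gives \<open>q = q \<cdot> e\<close>, and then
  \<open>\<theta>\<^sub>p(q) = \<theta>\<^sub>p(q) \<cdot> \<theta>\<^sub>e(e)\<close>. As \<open>\<theta>\<^sub>p(q)\<close> is arbitrary, \<open>\<theta>\<^sub>e(e)\<close> is a right identity, so \<open>(S, \<cdot>)\<close>
  is a left group, and dually for \<open>(S, \<circ>)\<close>.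

  If \<open>j\<close> is idempotent for both operations, \<open>\<theta>\<^sub>j\<close> is idempotent, it fixes \<open>E(S, \<cdot>)\<close> by
  irretractability, and every element of \<open>j \<cdot> S\<close> is of the form \<open>\<theta>\<^sub>j(p)\<close>. Hence \<open>\<theta>\<^sub>j = id\<close>, and \<open>j = 1\<close>
  by irretractability. So \<open>\<theta>\<^sub>e(e) = 1\<close> for all idempotents \<open>e\<close>, which yields \<open>1 \<circ> S = E(S, \<cdot>)\<close>
  and \<open>1 \<cdot> S \<subseteq> E(S, \<circ>)\<close>. The key identity is \<open>\<delta>\<^sub>x(a) = 1 \<circ> (a \<cdot> x)\<close>; the matched pair axioms and the
  coordinates of \<open>s\<close> then follow from \<open>\<theta>\<^sub>x(y) \<circ> (x \<cdot> y) = y\<close> by cancellation.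
\<close>

section \<open>Finite bijective solutions, by the components of the map and of its inverse\<close>

text \<open>\<open>dot_assoc\<close>, \<open>theta_dot\<close> and \<open>theta_theta\<close> are
  the components of the pentagon equation; \<open>circ_assoc\<close>, \<open>psi_circ\<close> and
  \<open>psi_psi\<close> are those for the inverse map conjugated by the flip. The last four axioms
  make the two maps mutually inverse.\<close>

locale pentagon_pair =
  fixes S :: "'a set"
    and dot :: "'a \<Rightarrow> 'a \<Rightarrow> 'a"  (infixl "\<cdot>" 70)
    and \<theta> :: "'a \<Rightarrow> 'a \<Rightarrow> 'a"
    and circ :: "'a \<Rightarrow> 'a \<Rightarrow> 'a"  (infixl "\<bullet>" 70)
    and \<psi> :: "'a \<Rightarrow> 'a \<Rightarrow> 'a"
  assumes fin: "finite S"
    and dot_closed [simp]: "\<lbrakk>x \<in> S; y \<in> S\<rbrakk> \<Longrightarrow> x \<cdot> y \<in> S"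
    and theta_closed [simp]: "\<lbrakk>x \<in> S; y \<in> S\<rbrakk> \<Longrightarrow> \<theta> x y \<in> S"
    and circ_closed [simp]: "\<lbrakk>x \<in> S; y \<in> S\<rbrakk> \<Longrightarrow> x \<bullet> y \<in> S"
    and psi_closed [simp]: "\<lbrakk>x \<in> S; y \<in> S\<rbrakk> \<Longrightarrow> \<psi> x y \<in> S"
    and dot_assoc: "\<lbrakk>x \<in> S; y \<in> S; z \<in> S\<rbrakk> \<Longrightarrow> (x \<cdot> y) \<cdot> z = x \<cdot> (y \<cdot> z)"
    and theta_dot: "\<lbrakk>x \<in> S; y \<in> S; z \<in> S\<rbrakk> \<Longrightarrow> \<theta> x (y \<cdot> z) = \<theta> x y \<cdot> \<theta> (x \<cdot> y) z"
    and theta_theta: "\<lbrakk>x \<in> S; y \<in> S; z \<in> S\<rbrakk> \<Longrightarrow> \<theta> (\<theta> x y) (\<theta> (x \<cdot> y) z) = \<theta> y z"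
    and circ_assoc: "\<lbrakk>x \<in> S; y \<in> S; z \<in> S\<rbrakk> \<Longrightarrow> (x \<bullet> y) \<bullet> z = x \<bullet> (y \<bullet> z)"
    and psi_circ: "\<lbrakk>x \<in> S; y \<in> S; z \<in> S\<rbrakk> \<Longrightarrow> \<psi> x (y \<bullet> z) = \<psi> x y \<bullet> \<psi> (x \<bullet> y) z"
    and psi_psi: "\<lbrakk>x \<in> S; y \<in> S; z \<in> S\<rbrakk> \<Longrightarrow> \<psi> (\<psi> x y) (\<psi> (x \<bullet> y) z) = \<psi> y z"
    and psi_dot_circ: "\<lbrakk>x \<in> S; y \<in> S\<rbrakk> \<Longrightarrow> \<psi> y x \<cdot> (y \<bullet> x) = x"
    and theta_psi_circ: "\<lbrakk>x \<in> S; y \<in> S\<rbrakk> \<Longrightarrow> \<theta> (\<psi> y x) (y \<bullet> x) = y"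
    and theta_circ_dot: "\<lbrakk>x \<in> S; y \<in> S\<rbrakk> \<Longrightarrow> \<theta> x y \<bullet> (x \<cdot> y) = y"
    and psi_theta_dot: "\<lbrakk>x \<in> S; y \<in> S\<rbrakk> \<Longrightarrow> \<psi> (\<theta> x y) (x \<cdot> y) = x"
begin

text \<open>The axioms are symmetric: conjugating the inverse map by the flip is again a solution.\<close>

lemma dual: "pentagon_pair S (\<bullet>) \<psi> (\<cdot>) \<theta>"
  by unfold_locales
    (simp_all add: fin dot_assoc theta_dot theta_theta circ_assoc psi_circ psi_psi
      psi_dot_circ theta_psi_circ theta_circ_dot psi_theta_dot)

text \<open>The pair \<open>(w, v)\<close> is the image of
  \<open>(\<psi> v w, v \<bullet> w)\<close>; \<open>theta_theta\<close> at this preimage is the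
  claim.\<close>

lemma theta_hom: "\<lbrakk>v \<in> S; w \<in> S; x \<in> S\<rbrakk> \<Longrightarrow> \<theta> v (\<theta> w x) = \<theta> (v \<bullet> w) x"
  using theta_theta[of "\<psi> v w" "v \<bullet> w" x] by (simp add: psi_dot_circ theta_psi_circ)

section \<open>The left group structure\<close>

text \<open>For a right ideal \<open>I\<close> of \<open>(S, \<cdot>)\<close> the injective map \<open>(x, y) \<mapsto> (x \<cdot> y, \<theta> x y)\<close> sends the finite
  set \<open>I \<times> S\<close> into itself, hence onto itself, so \<open>x \<cdot> y \<in> I\<close> forces \<open>x \<in> I\<close>. The lemma is the case
  of the right ideal generated by \<open>x \<cdot> y\<close>.\<close>

lemma dot_recover:
  assumes x: "x \<in> S" and y: "y \<in> S"
  shows "x = x \<cdot> y \<or> (\<exists>t\<in>S. x = x \<cdot> y \<cdot> t)"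
proof -
  define I where "I = insert (x \<cdot> y) ((\<lambda>t. x \<cdot> y \<cdot> t) ` S)"
  define h where "h = (\<lambda>(p, q). (p \<cdot> q, \<theta> p q))"
  have I_sub: "I \<subseteq> S" using x y by (auto simp: I_def)
  have inj: "inj_on h (S \<times> S)"
    by (rule inj_on_inverseI[where g = "\<lambda>(p, q). (\<psi> q p, q \<bullet> p)"])
      (auto simp: h_def theta_circ_dot psi_theta_dot)
  have "h ` (I \<times> S) \<subseteq> I \<times> S"
    using x y by (auto simp: h_def I_def dot_assoc)
  moreover have "inj_on h (I \<times> S)"
    using inj I_sub by (auto intro: inj_on_subset)
  moreover have "finite (I \<times> S)"
    using fin I_sub by (auto intro: finite_subset)
  ultimately have onto: "h ` (I \<times> S) = I \<times> S"
    by (intro endo_inj_surj)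
  have "h (x, y) \<in> I \<times> S"
    using x y by (simp add: h_def I_def)
  then have "h (x, y) \<in> h ` (I \<times> S)" by (simp only: onto)
  then obtain p where p: "h (x, y) = h p" "p \<in> I \<times> S" by (rule imageE)
  have "(x, y) = p"
    by (rule inj_onD[OF inj]) (use p I_sub x y in auto)
  with p(2) show ?thesis by (auto simp: I_def)
qed

text \<open>By \<open>dot_recover\<close>, \<open>p\<close> is \<open>e = p \<cdot> q\<close> itself
  or lies in \<open>e \<cdot> S\<close>, where the idempotent \<open>e\<close> is a left
  identity.\<close>

lemma factor_left_id:
  assumes "p \<in> S" "q \<in> S" "p \<cdot> q \<cdot> (p \<cdot> q) = p \<cdot> q"
  shows "p \<cdot> q \<cdot> p = p"
  using dot_recover[OF assms(1,2)]
proof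
  assume "p = p \<cdot> q"
  then show ?thesis using assms(3) by simp
next
  assume "\<exists>t\<in>S. p = p \<cdot> q \<cdot> t"
  then obtain t where t: "t \<in> S" "p = p \<cdot> q \<cdot> t" by blast
  have "p \<cdot> q \<cdot> (p \<cdot> q \<cdot> t) = p \<cdot> q \<cdot> (p \<cdot> q) \<cdot> t"
    using assms(1,2) t(1) by (simp only: dot_assoc dot_closed)
  also have "\<dots> = p" by (simp only: assms(3) t(2)[symmetric])
  finally show ?thesis by (simp only: t(2)[symmetric])
qed

text \<open>Since \<open>p \<cdot> q \<cdot> p = p\<close>, the product \<open>q \<cdot> p\<close>
  is idempotent as well, so \<open>factor_left_id\<close> applies with the factors
  exchanged.\<close>

lemma factor_right_id:
  assumes p: "p \<in> S" and q: "q \<in> S" and e: "p \<cdot> q \<cdot> (p \<cdot> q) = p \<cdot> q"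
  shows "q \<cdot> (p \<cdot> q) = q"
proof -
  have "q \<cdot> p \<cdot> (q \<cdot> p) = q \<cdot> (p \<cdot> q \<cdot> p)"
    using p q by (simp add: dot_assoc)
  then have "q \<cdot> p \<cdot> (q \<cdot> p) = q \<cdot> p"
    using factor_left_id[OF p q e] by simp
  then have "q \<cdot> p \<cdot> q = q" by (rule factor_left_id[OF q p])
  then show ?thesis using p q by (simp add: dot_assoc)
qed

lemma dot_theta_idem:
  assumes e: "e \<in> S" "e \<cdot> e = e" and v: "v \<in> S"
  shows "v \<cdot> \<theta> e e = v"
proof -
  \<comment> \<open>\<open>(p, q)\<close> is the preimage of \<open>(e, v)\<close>, so an arbitrary
    \<open>v\<close> is a value \<open>\<theta> p q\<close> with
    \<open>p \<cdot> q = e\<close>.\<close>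
  define p where "p = \<psi> v e"
  define q where "q = v \<bullet> e"
  have pq: "p \<in> S" "q \<in> S" "p \<cdot> q = e" "\<theta> p q = v"
    using e v by (simp_all add: p_def q_def psi_dot_circ theta_psi_circ)
  have "q \<cdot> e = q" using factor_right_id[of p q] pq e by simp
  then show ?thesis using theta_dot[of p q e] pq e by simp
qed

lemma dot_right_inverse:
  assumes e: "e \<in> S" "e \<cdot> e = e" and w: "w \<in> S" "w \<cdot> w = w" "\<And>x. x \<in> S \<Longrightarrow> x \<cdot> w = x"
    and y: "y \<in> S"
  shows "\<exists>t\<in>S. e \<cdot> y \<cdot> t = e"
proof -
  from dot_recover[OF e(1) y] show ?thesis
  proof
    assume "e = e \<cdot> y"
    then show ?thesis using w e by metis
  qed (metis)
qed

text \<open>The right identity \<open>w = \<theta> e e\<close> makes \<open>w \<cdot> e\<close>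
  idempotent. Cancelling with its right inverse \<open>t\<close> gives
  \<open>w \<cdot> e = w\<close>, and then
  \<open>x \<cdot> e = x \<cdot> w \<cdot> e = x \<cdot> w = x\<close>.\<close>

lemma dot_idem:
  assumes e: "e \<in> S" "e \<cdot> e = e" and x: "x \<in> S"
  shows "x \<cdot> e = x"
proof -
  define w where "w = \<theta> e e"
  have w: "w \<in> S" using e by (simp add: w_def)
  have wr: "y \<cdot> w = y" if "y \<in> S" for y
    using dot_theta_idem[OF e that] by (simp add: w_def)
  obtain t where t: "t \<in> S" "w \<cdot> e \<cdot> t = w"
    using dot_right_inverse[OF w wr[OF w] w wr[OF w] wr e(1)] by blast
  have "w \<cdot> e \<cdot> (w \<cdot> e) = w \<cdot> (e \<cdot> w) \<cdot> e"
    using w e by (simp add: dot_assoc)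
  also have "\<dots> = w \<cdot> e" using w e wr by (simp add: dot_assoc)
  finally have "w \<cdot> e \<cdot> (w \<cdot> e \<cdot> t) = w \<cdot> e \<cdot> t"
    using w e t by (metis dot_assoc dot_closed)
  then have "w \<cdot> e = w" using t wr w e by simp
  then have "x \<cdot> w \<cdot> e = x \<cdot> w" using x w e by (simp add: dot_assoc)
  then show ?thesis using wr x by simp
qed

lemma group_dot:
  assumes e: "e \<in> S" "e \<cdot> e = e"
  shows "group \<lparr>carrier = (\<cdot>) e ` S, mult = (\<cdot>), one = e\<rparr>" (is "group ?G")
proof (rule groupI)
  have carr: "x \<in> carrier ?G \<longleftrightarrow> x \<in> S \<and> e \<cdot> x = x" for x
    using e dot_assoc[OF e(1) e(1)] by (force simp: image_iff)
  have inv: "\<exists>y \<in> carrier ?G. x \<cdot> y = e" if x: "x \<in> carrier ?G" for x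
  proof -
    have xS: "x \<in> S" "e \<cdot> x = x" using x carr by auto
    obtain t where t: "t \<in> S" "e \<cdot> x \<cdot> t = e"
      using dot_right_inverse[OF e e dot_idem[OF e] xS(1)] by blast
    have "x \<cdot> (e \<cdot> t) = x \<cdot> e \<cdot> t" using xS e t by (simp add: dot_assoc)
    then have "x \<cdot> (e \<cdot> t) = e" using xS t dot_idem[OF e] by simp
    moreover have "e \<cdot> t \<in> carrier ?G" using t by simp
    ultimately show ?thesis by blast
  qed
  show "\<one>\<^bsub>?G\<^esub> \<in> carrier ?G" using e by force
  fix x assume x: "x \<in> carrier ?G"
  then have xS: "x \<in> S" "e \<cdot> x = x" using carr by auto
  show "\<one>\<^bsub>?G\<^esub> \<otimes>\<^bsub>?G\<^esub> x = x" using xS by simp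
  \<comment> \<open>Right inverses are two-sided: if \<open>y\<close> is one of \<open>x\<close> and
    \<open>z\<close> one of \<open>y\<close>, then
    \<open>x = x \<cdot> y \<cdot> z = z\<close>.\<close>
  obtain y where y: "y \<in> carrier ?G" "x \<cdot> y = e" using inv x by blast
  obtain z where z: "z \<in> carrier ?G" "y \<cdot> z = e" using inv y by blast
  have yz: "y \<in> S" "e \<cdot> y = y" "z \<in> S" "e \<cdot> z = z" using y z carr by auto
  have "x \<cdot> (y \<cdot> z) = x \<cdot> y \<cdot> z" using xS yz by (simp add: dot_assoc)
  then have "x = z" using y z yz dot_idem[OF e xS(1)] by simp
  then show "\<exists>y\<in>carrier ?G. y \<otimes>\<^bsub>?G\<^esub> x = \<one>\<^bsub>?G\<^esub>"
    using y(1) z(2) by (intro bexI[of _ y]) simp_all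
  fix y assume "y \<in> carrier ?G"
  then have y: "y \<in> S" "e \<cdot> y = y" using carr by auto
  show "x \<otimes>\<^bsub>?G\<^esub> y \<in> carrier ?G"
    using carr[of "x \<cdot> y"] xS y e by (simp flip: dot_assoc)
  fix z assume "z \<in> carrier ?G"
  then show "x \<otimes>\<^bsub>?G\<^esub> y \<otimes>\<^bsub>?G\<^esub> z = x \<otimes>\<^bsub>?G\<^esub> (y \<otimes>\<^bsub>?G\<^esub> z)"
    using carr xS y by (simp add: dot_assoc)
qed

text \<open>The preimage \<open>(p, q)\<close> of \<open>(z, v)\<close> satisfies
  \<open>q \<cdot> e = q\<close>, so \<open>theta_dot\<close> gives
  \<open>v = v \<cdot> \<theta> z e\<close>; the choice \<open>v = \<theta> z e\<close> yields the
  claim.\<close>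

lemma theta_idem:
  assumes e: "e \<in> S" "e \<cdot> e = e" and z: "z \<in> S"
  shows "\<theta> z e \<cdot> \<theta> z e = \<theta> z e"
proof -
  define v where "v = \<theta> z e"
  have v: "v \<in> S" using e z by (simp add: v_def)
  have "\<theta> (\<psi> v z) ((v \<bullet> z) \<cdot> e) = v \<cdot> \<theta> z e"
    using theta_dot[of "\<psi> v z" "v \<bullet> z" e] e z v by (simp add: psi_dot_circ theta_psi_circ)
  then show ?thesis
    using e z v dot_idem[OF e] by (simp add: theta_psi_circ v_def)
qed

lemma decompose:
  assumes e: "e \<in> S" "e \<cdot> e = e" and x: "x \<in> S"
  obtains f where "f \<in> S" "f \<cdot> f = f" "x = f \<cdot> (e \<cdot> x)"
proof -
  let ?G = "\<lparr>carrier = (\<cdot>) e ` S, mult = (\<cdot>), one = e\<rparr>"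
  interpret G: group ?G by (rule group_dot[OF e])
  have g: "e \<cdot> x \<in> carrier ?G" using x by simp
  \<comment> \<open>The idempotent factor is \<open>x \<cdot> h\<close>, with \<open>h\<close> the
    inverse of the group component \<open>e \<cdot> x\<close>.\<close>
  define h where "h = inv\<^bsub>?G\<^esub> (e \<cdot> x)"
  have hg: "h \<cdot> (e \<cdot> x) = e" using G.l_inv[OF g] by (simp add: h_def)
  have "h \<in> carrier ?G" using G.inv_closed[OF g] by (simp add: h_def)
  then have h: "h \<in> S" "h \<cdot> e = h" using e dot_idem[OF e] by auto
  have hx: "h \<cdot> x = e" using hg h e x by (metis dot_assoc)
  show ?thesis
  proof
    show "x \<cdot> h \<in> S" using x h by simp
    have "x \<cdot> h \<cdot> (x \<cdot> h) = x \<cdot> (h \<cdot> x) \<cdot> h" using x h by (simp add: dot_assoc)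
    then show "x \<cdot> h \<cdot> (x \<cdot> h) = x \<cdot> h" using hx dot_idem[OF e x] by simp
    have "x \<cdot> h \<cdot> (e \<cdot> x) = x \<cdot> (h \<cdot> (e \<cdot> x))" using x h e by (simp add: dot_assoc)
    then show "x = x \<cdot> h \<cdot> (e \<cdot> x)" using hg dot_idem[OF e x] by simp
  qed
qed

end

section \<open>Elements idempotent for both operations\<close>

context pentagon_pair
begin

interpretation D: pentagon_pair S "(\<bullet>)" \<psi> "(\<cdot>)" \<theta>
  by (rule dual)

text \<open>The dual of \<open>dot_recover\<close> puts \<open>w\<close> in
  \<open>{e} \<union> e \<bullet> S\<close>, where \<open>w\<close> acts as a left identity.\<close>

lemma circ_idem_if_left_id:
  assumes "w \<in> S" "e \<in> S" "w \<bullet> e = e"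
  shows "w \<bullet> w = w"
  using D.dot_recover[of w e] assms by (metis circ_assoc)

lemma theta_idem_circ_idem:
  assumes e: "e \<in> S" "e \<cdot> e = e"
  shows "\<theta> e e \<bullet> \<theta> e e = \<theta> e e"
  using circ_idem_if_left_id[of "\<theta> e e" e] theta_circ_dot[of e e] e by simp

text \<open>As \<open>j \<bullet> j = j\<close>, the map \<open>\<theta> j\<close> is idempotent and
  fixes its values, so it suffices to write \<open>v\<close> as \<open>\<theta> j p\<close>.\<close>

lemma theta_common_idem_fixes_factor:
  assumes j: "j \<in> S" "j \<cdot> j = j" "j \<bullet> j = j" and jj: "\<theta> j j = j" and v: "v \<in> (\<cdot>) j ` S"
  shows "\<theta> j v = v"
proof -
  let ?G = "\<lparr>carrier = (\<cdot>) j ` S, mult = (\<cdot>), one = j\<rparr>"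
  interpret G: group ?G by (rule group_dot[OF j(1,2)])
  have vG: "v \<in> carrier ?G" using v by simp
  define w where "w = inv\<^bsub>?G\<^esub> v"
  have wv: "w \<cdot> v = j" using G.l_inv[OF vG] by (simp add: w_def)
  have "w \<in> carrier ?G" using G.inv_closed[OF vG] by (simp add: w_def)
  then have w: "w \<in> S" using j by auto
  have vS: "v \<in> S" "j \<cdot> v = v" using v j G.l_one[OF vG] by auto
  \<comment> \<open>\<open>(p, q)\<close> is the preimage of \<open>(j, w)\<close>. Expanding
    \<open>\<theta> j (p \<cdot> q) = j\<close> shows that \<open>\<theta> j p\<close> is the
    inverse of \<open>w\<close>, which is \<open>v\<close>.\<close>
  define p where "p = \<psi> w j"
  define q where "q = w \<bullet> j"
  have pq: "p \<in> S" "q \<in> S" "p \<cdot> q = j" "\<theta> p q = w"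
    using j w by (simp_all add: p_def q_def psi_dot_circ theta_psi_circ)
  have jp: "j \<cdot> p = p" using factor_left_id[of p q] pq j by simp
  have a: "\<theta> j p \<cdot> w = j" using theta_dot[of j p q] pq jp jj j by simp
  have "\<theta> j p = \<theta> j p \<cdot> (w \<cdot> v)" using wv j pq dot_idem[OF j(1,2)] by simp
  also have "\<dots> = \<theta> j p \<cdot> w \<cdot> v" using j pq w vS by (simp add: dot_assoc)
  also have "\<dots> = v" using a vS by simp
  finally have b: "\<theta> j p = v" .
  show ?thesis using theta_hom[of j j p] j pq b by simp
qed

end

section \<open>Irretractable solutions and the unique common idempotent\<close>

locale irretractable_pair = pentagon_pair +
  fixes u
  assumes u: "u \<in> S" "u \<cdot> u = u" "u \<bullet> u = u"
    and theta_faithful: "\<lbrakk>e \<in> S; e \<cdot> e = e; f \<in> S; f \<cdot> f = f; \<And>y. y \<in> S \<Longrightarrow> \<theta> e y = \<theta> f y\<rbrakk> \<Longrightarrow> e = f"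
begin

interpretation D: pentagon_pair S "(\<bullet>)" \<psi> "(\<cdot>)" \<theta>
  by (rule dual)

abbreviation A where "A \<equiv> \<lparr>carrier = (\<bullet>) u ` S, mult = (\<bullet>), one = u\<rparr>"
abbreviation G where "G \<equiv> \<lparr>carrier = (\<cdot>) u ` S, mult = (\<cdot>), one = u\<rparr>"

lemma group_A: "group A" by (rule D.group_dot[OF u(1,3)])

lemma group_G: "group G" by (rule group_dot[OF u(1,2)])

interpretation A: group A by (rule group_A)

interpretation G: group G by (rule group_G)

text \<open>By faithfulness it suffices that \<open>\<theta> j e\<close> and \<open>e\<close> act
  alike. Replacing \<open>\<theta> j e\<close> by \<open>\<theta> j e \<bullet> j\<close> and
  \<open>j\<close> by \<open>j \<cdot> e\<close> brings the action into the form of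
  \<open>theta_theta\<close>.\<close>

lemma theta_common_idem_fixes_idem:
  assumes j: "j \<in> S" "j \<bullet> j = j" and e: "e \<in> S" "e \<cdot> e = e"
  shows "\<theta> j e = e"
proof (rule theta_faithful)
  fix y assume y: "y \<in> S"
  have "\<theta> (\<theta> j e) y = \<theta> (\<theta> j e \<bullet> j) y"
    using D.dot_idem[OF j, of "\<theta> j e"] j e by simp
  also have "\<dots> = \<theta> (\<theta> j e) (\<theta> j y)" using theta_hom j e y by simp
  also have "\<dots> = \<theta> e y"
    using theta_theta[of j e y] j e y dot_idem[OF e j(1)] by simp
  finally show "\<theta> (\<theta> j e) y = \<theta> e y" .
qed (use j e theta_idem in auto)

lemma theta_common_idem:
  assumes j: "j \<in> S" "j \<cdot> j = j" "j \<bullet> j = j" and x: "x \<in> S"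
  shows "\<theta> j x = x"
proof -
  obtain e where e: "e \<in> S" "e \<cdot> e = e" "x = e \<cdot> (j \<cdot> x)"
    using decompose[OF j(1,2) x] .
  have "\<theta> j (j \<cdot> x) = j \<cdot> x"
    by (rule theta_common_idem_fixes_factor[OF j theta_common_idem_fixes_idem[OF j(1,3,1,2)]])
      (use x in simp)
  moreover have "\<theta> j (e \<cdot> (j \<cdot> x)) = \<theta> j e \<cdot> \<theta> (j \<cdot> e) (j \<cdot> x)"
    using j e(1,2) x by (intro theta_dot) auto
  ultimately show ?thesis
    using theta_common_idem_fixes_idem[OF j(1,3) e(1,2)] dot_idem[OF e(1,2) j(1)] e(3) by simp
qed

lemma common_idem_eq: "\<lbrakk>j \<in> S; j \<cdot> j = j; j \<bullet> j = j\<rbrakk> \<Longrightarrow> j = u"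
  by (rule theta_faithful) (use theta_common_idem u in auto)

text \<open>Hence the distinguished element does not depend on the idempotent chosen to define
  it.\<close>

lemma theta_self_idem: "\<lbrakk>e \<in> S; e \<cdot> e = e\<rbrakk> \<Longrightarrow> \<theta> e e = u"
  by (rule common_idem_eq) (use theta_idem theta_idem_circ_idem in auto)

lemma dot_idem_u_circ: "\<lbrakk>e \<in> S; e \<cdot> e = e\<rbrakk> \<Longrightarrow> u \<bullet> e = e"
  using theta_circ_dot[of e e] theta_self_idem[of e] by simp

lemma theta_u: "x \<in> S \<Longrightarrow> \<theta> u x = x"
  using theta_common_idem u by simp

lemma circ_u: "x \<in> S \<Longrightarrow> x \<bullet> u = x"
  by (rule D.dot_idem[OF u(1,3)])

lemma dot_u: "x \<in> S \<Longrightarrow> x \<cdot> u = x"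
  by (rule dot_idem[OF u(1,2)])

lemma u_circ_idem:
  assumes x: "x \<in> S"
  shows "(u \<bullet> x) \<cdot> (u \<bullet> x) = u \<bullet> x"
proof -
  \<comment> \<open>\<open>f\<close> is a left inverse of \<open>x\<close> for
    \<open>\<bullet>\<close>, and \<open>f'\<close> one of \<open>f\<close>; so
    \<open>u \<bullet> x = f'\<close>, which is idempotent for \<open>\<cdot>\<close> as a value of
    \<open>\<theta>\<close> at \<open>u\<close>.\<close>
  define f where "f = \<theta> x u"
  define f' where "f' = \<theta> f u"
  have f: "f \<in> S" "f \<bullet> x = u"
    using x u theta_circ_dot[of x u] dot_u by (simp_all add: f_def)
  have f': "f' \<in> S" "f' \<cdot> f' = f'" "f' \<bullet> f = u"
    using f u theta_circ_dot[of f u] dot_u theta_idem[OF u(1,2)] by (simp_all add: f'_def)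
  have "f' \<bullet> f \<bullet> x = f' \<bullet> (f \<bullet> x)" by (rule circ_assoc[OF f'(1) f(1) x])
  then have "u \<bullet> x = f'" using f f' circ_u by simp
  then show ?thesis using f' by simp
qed

lemma carrier_A: "a \<in> carrier A \<longleftrightarrow> a \<in> S \<and> a \<cdot> a = a"
proof
  assume "a \<in> carrier A"
  then show "a \<in> S \<and> a \<cdot> a = a" using u_circ_idem u by auto
next
  assume "a \<in> S \<and> a \<cdot> a = a"
  then show "a \<in> carrier A" by (auto intro!: image_eqI[of _ _ a] simp: dot_idem_u_circ)
qed

lemma u_circ_A: "a \<in> carrier A \<Longrightarrow> u \<bullet> a = a"
  using A.l_one[of a] by simp

lemma theta_circ_idem:
  assumes i: "i \<in> S" "i \<bullet> i = i" and x: "x \<in> S"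
  shows "\<theta> i x = x"
proof -
  have "\<theta> u (\<theta> i x) = \<theta> (u \<bullet> i) x" using i x u by (intro theta_hom)
  then show ?thesis using D.dot_idem[OF i u(1)] theta_u i x by simp
qed

text \<open>\<open>\<theta> i\<close> is the identity, so
  \<open>y \<bullet> (i \<cdot> y) = y\<close>. Cancelling in the group \<open>A\<close> makes the
  group component of \<open>i \<cdot> y\<close> trivial.\<close>

lemma circ_idem_dot:
  assumes i: "i \<in> S" "i \<bullet> i = i" and y: "y \<in> S"
  shows "(i \<cdot> y) \<bullet> (i \<cdot> y) = i \<cdot> y"
proof -
  have "y \<bullet> (i \<cdot> y) = y"
    using theta_circ_dot[of i y] theta_circ_idem[OF i y] i y by simp
  then have c: "(u \<bullet> y) \<bullet> (u \<bullet> (i \<cdot> y)) = u \<bullet> y"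
    using i y u by (metis circ_assoc circ_closed circ_u dot_closed)
  have "u \<bullet> y \<in> carrier A" "u \<bullet> (i \<cdot> y) \<in> carrier A" using i y by auto
  then have "u \<bullet> (i \<cdot> y) = u" using c A.l_cancel_one[of "u \<bullet> y" "u \<bullet> (i \<cdot> y)"] by simp
  then have "(i \<cdot> y) \<bullet> u = (i \<cdot> y) \<bullet> (i \<cdot> y)"
    using i y u by (metis circ_assoc circ_u dot_closed)
  then show ?thesis using circ_u i y by simp
qed

lemma carrier_G: "x \<in> carrier G \<Longrightarrow> x \<in> S \<and> u \<cdot> x = x \<and> x \<bullet> x = x"
  using G.l_one[of x] circ_idem_dot[OF u(1,3)] u by auto

lemma theta_u_circ: "\<lbrakk>x \<in> S; y \<in> S\<rbrakk> \<Longrightarrow> \<theta> (u \<bullet> x) y = \<theta> x y"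
  using theta_hom[of u x y] theta_u u by simp

text \<open>In a left group a left factor determines only the group component of the other factor,
  hence the \<open>u\<close> in the conclusion.\<close>

lemma circ_left_cancel:
  assumes "w \<in> S" "p \<in> S" "q \<in> S" "w \<bullet> p = w \<bullet> q"
  shows "u \<bullet> p = u \<bullet> q"
proof -
  have "(u \<bullet> w) \<bullet> (u \<bullet> p) = (u \<bullet> w) \<bullet> (u \<bullet> q)"
    using assms u by (metis circ_assoc circ_closed circ_u)
  moreover have "u \<bullet> w \<in> carrier A" "u \<bullet> p \<in> carrier A" "u \<bullet> q \<in> carrier A"
    using assms by auto
  ultimately show ?thesis
    using A.Units_l_cancel[of "u \<bullet> w" "u \<bullet> p" "u \<bullet> q"] by simp
qed

lemma circ_u_circ: "\<lbrakk>x \<in> S; y \<in> S\<rbrakk> \<Longrightarrow> x \<bullet> (u \<bullet> y) = x \<bullet> y"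
  using circ_u u by (simp flip: circ_assoc)

lemma dot_u_dot: "\<lbrakk>x \<in> S; y \<in> S\<rbrakk> \<Longrightarrow> x \<cdot> (u \<cdot> y) = x \<cdot> y"
  using dot_u u by (simp flip: dot_assoc)

text \<open>\<open>z\<close> and \<open>u \<bullet> z\<close> have the same \<open>\<theta>\<close>,
  so both products give \<open>y\<close> when multiplied on the left by
  \<open>\<theta> z y\<close>.\<close>

lemma u_circ_dot:
  assumes z: "z \<in> S" and y: "y \<in> S"
  shows "u \<bullet> ((u \<bullet> z) \<cdot> y) = u \<bullet> (z \<cdot> y)"
proof (rule circ_left_cancel)
  show "\<theta> z y \<bullet> ((u \<bullet> z) \<cdot> y) = \<theta> z y \<bullet> (z \<cdot> y)"
    using theta_circ_dot[of "u \<bullet> z" y] theta_circ_dot[of z y] theta_u_circ z y u by simp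
qed (use z y u in auto)

section \<open>The matched pair of actions\<close>

definition \<sigma> where "\<sigma> a x = u \<cdot> \<theta> a x"

definition \<delta> where "\<delta> x a = inv\<^bsub>A\<^esub> (u \<bullet> \<psi> (inv\<^bsub>G\<^esub> x) (inv\<^bsub>A\<^esub> a))"

text \<open>With \<open>b\<close> and \<open>y\<close> the inverses of \<open>a\<close> and
  \<open>x\<close>, the map sends \<open>(a \<cdot> x, y)\<close> to
  \<open>(a, y \<bullet> b)\<close>, so \<open>\<psi> (y \<bullet> b) a = a \<cdot> x\<close>.
  Expanding \<open>\<psi> y (b \<bullet> a)\<close> then shows \<open>u \<bullet> \<psi> y b\<close>
  and \<open>u \<bullet> (a \<cdot> x)\<close> to be inverse in \<open>A\<close>.\<close>

lemma delta_eq: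
  assumes a: "a \<in> carrier A" and x: "x \<in> carrier G"
  shows "\<delta> x a = u \<bullet> (a \<cdot> x)"
proof -
  define b where "b = inv\<^bsub>A\<^esub> a"
  define y where "y = inv\<^bsub>G\<^esub> x"
  have bA: "b \<in> carrier A" and yG: "y \<in> carrier G"
    unfolding b_def y_def by (rule A.inv_closed[OF a] G.inv_closed[OF x])+
  have ab: "a \<bullet> b = u" "b \<bullet> a = u" and xy: "x \<cdot> y = u"
    using A.r_inv[OF a] A.l_inv[OF a] G.r_inv[OF x] by (simp_all add: b_def y_def)
  have aS: "a \<in> S" "b \<in> S" "x \<in> S" "y \<in> S"
    using a bA x yG carrier_A carrier_G by blast+
  define t where "t = \<theta> (a \<cdot> x) y"
  have t: "t \<in> S" using aS by (simp add: t_def)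
  have axy: "a \<cdot> x \<cdot> y = a" using aS xy dot_u by (simp add: dot_assoc)
  have "t \<bullet> a = y" using theta_circ_dot[of "a \<cdot> x" y] aS axy by (simp add: t_def)
  then have "y \<bullet> b = t \<bullet> (a \<bullet> b)" using aS t by (simp flip: circ_assoc)
  then have "y \<bullet> b = t" using ab circ_u t by simp
  then have 1: "\<psi> (y \<bullet> b) a = a \<cdot> x"
    using psi_theta_dot[of "a \<cdot> x" y] aS axy by (simp add: t_def)
  have "u \<bullet> \<psi> y u = u"
    using D.dot_idem[OF _ D.theta_idem[OF u(1,3) aS(4)] u(1)] u aS by simp
  then have "u = u \<bullet> (\<psi> y b \<bullet> (a \<cdot> x))" using psi_circ[of y b a] 1 ab aS by simp
  then have "(u \<bullet> \<psi> y b) \<bullet> (u \<bullet> (a \<cdot> x)) = u"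
    using aS u circ_u_circ by (simp add: circ_assoc)
  then have "inv\<^bsub>A\<^esub> (u \<bullet> (a \<cdot> x)) = u \<bullet> \<psi> y b"
    using aS by (intro A.inv_equality) simp_all
  then have "inv\<^bsub>A\<^esub> (u \<bullet> \<psi> y b) = u \<bullet> (a \<cdot> x)"
    using A.inv_inv[of "u \<bullet> (a \<cdot> x)"] aS by simp
  then show ?thesis by (simp add: \<delta>_def b_def y_def)
qed

text \<open>The factor \<open>\<theta> x u\<close> split off by \<open>theta_dot\<close> is
  idempotent, hence absorbed by \<open>u\<close> on its left.\<close>

lemma u_dot_theta: "\<lbrakk>x \<in> S; y \<in> S\<rbrakk> \<Longrightarrow> u \<cdot> \<theta> x (u \<cdot> y) = u \<cdot> \<theta> x y"
  using theta_dot[of x u y] dot_idem[OF _ theta_idem[OF u(1,2), of x] u(1)] dot_u u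
  by (simp flip: dot_assoc)

lemma sigma_closed: "\<lbrakk>a \<in> S; x \<in> S\<rbrakk> \<Longrightarrow> \<sigma> a x \<in> carrier G"
  by (simp add: \<sigma>_def)

lemma sigma_action: "\<lbrakk>a \<in> S; b \<in> S; x \<in> S\<rbrakk> \<Longrightarrow> \<sigma> (a \<bullet> b) x = \<sigma> a (\<sigma> b x)"
  by (simp add: \<sigma>_def u_dot_theta theta_hom)

text \<open>This replaces the index \<open>\<delta> x a = u \<bullet> (a \<cdot> x)\<close> of
  \<open>\<sigma>\<close> by \<open>a \<cdot> x\<close>.\<close>

lemma sigma_u_circ: "\<lbrakk>a \<in> S; x \<in> S\<rbrakk> \<Longrightarrow> \<sigma> (u \<bullet> a) x = \<sigma> a x"
  by (simp add: \<sigma>_def theta_u_circ)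

lemma delta_closed:
  assumes a: "a \<in> carrier A" and x: "x \<in> carrier G"
  shows "\<delta> x a \<in> carrier A"
proof -
  have "a \<in> S" "x \<in> S" using a x carrier_A carrier_G by blast+
  then show ?thesis using delta_eq[OF a x] by simp
qed

lemma delta_action:
  assumes x: "x \<in> carrier G" and y: "y \<in> carrier G" and a: "a \<in> carrier A"
  shows "\<delta> (x \<cdot> y) a = \<delta> y (\<delta> x a)"
proof -
  have S: "x \<in> S" "y \<in> S" "a \<in> S" using x y a carrier_A carrier_G by blast+
  have "x \<cdot> y \<in> carrier G" using G.m_closed[OF x y] by simp
  then have "\<delta> (x \<cdot> y) a = u \<bullet> (a \<cdot> x \<cdot> y)"
    using delta_eq[OF a] S by (simp add: dot_assoc)
  also have "\<dots> = u \<bullet> ((u \<bullet> (a \<cdot> x)) \<cdot> y)" using u_circ_dot S by simp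
  also have "\<dots> = \<delta> y (\<delta> x a)"
    using delta_eq[OF delta_closed[OF a x] y] delta_eq[OF a x] by simp
  finally show ?thesis .
qed

lemma sigma_mult:
  assumes a: "a \<in> carrier A" and x: "x \<in> carrier G" and y: "y \<in> carrier G"
  shows "\<sigma> a (x \<cdot> y) = \<sigma> a x \<cdot> \<sigma> (\<delta> x a) y"
proof -
  have S: "x \<in> S" "y \<in> S" "a \<in> S" using x y a carrier_A carrier_G by blast+
  then have "\<sigma> (\<delta> x a) y = u \<cdot> \<theta> (a \<cdot> x) y"
    using delta_eq[OF a x] sigma_u_circ[of "a \<cdot> x" y] by (simp add: \<sigma>_def)
  then show ?thesis
    using S u by (simp add: \<sigma>_def theta_dot dot_assoc dot_u_dot)
qed

text \<open>Left multiplication by \<open>w = \<theta> a (\<theta> b x)\<close> takes both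
  \<open>(a \<bullet> b) \<cdot> x\<close> and
  \<open>(a \<cdot> \<theta> b x) \<bullet> (b \<cdot> x)\<close> to \<open>x\<close>; then
  \<open>w\<close> is cancelled.\<close>

lemma delta_mult:
  assumes x: "x \<in> carrier G" and a: "a \<in> carrier A" and b: "b \<in> carrier A"
  shows "\<delta> x (a \<bullet> b) = \<delta> (\<sigma> b x) a \<bullet> \<delta> x b"
proof -
  have S: "x \<in> S" "a \<in> S" "b \<in> S" using x a b carrier_A carrier_G by blast+
  have ab: "a \<bullet> b \<in> carrier A" using A.m_closed[OF a b] by simp
  define w where "w = \<theta> a (\<theta> b x)"
  have w: "w \<in> S" using S by (simp add: w_def)
  have "w \<bullet> ((a \<bullet> b) \<cdot> x) = x"
    using theta_circ_dot[of "a \<bullet> b" x] S by (simp add: w_def theta_hom)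
  moreover have "w \<bullet> ((a \<cdot> \<theta> b x) \<bullet> (b \<cdot> x)) = x"
    using theta_circ_dot[of a "\<theta> b x"] theta_circ_dot[of b x] S
    by (simp add: w_def flip: circ_assoc)
  ultimately have "u \<bullet> ((a \<bullet> b) \<cdot> x) = u \<bullet> ((a \<cdot> \<theta> b x) \<bullet> (b \<cdot> x))"
    using S w by (intro circ_left_cancel[of w]) simp_all
  moreover have "a \<cdot> \<sigma> b x = a \<cdot> \<theta> b x"
    using S by (simp add: \<sigma>_def dot_u_dot)
  ultimately show ?thesis
    using delta_eq[OF ab x] delta_eq[OF a sigma_closed[OF S(3,1)]] delta_eq[OF b x] S u
    by (simp add: circ_assoc circ_u_circ)
qed

lemma matched_pair_sigma_delta: "matched_pair A G \<sigma> \<delta>"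
proof
  have AS: "a \<in> S" if "a \<in> carrier A" for a using that carrier_A by blast
  have GS: "x \<in> S" "u \<cdot> x = x" if "x \<in> carrier G" for x using that carrier_G by blast+
  show "\<sigma> (a \<otimes>\<^bsub>A\<^esub> b) x = \<sigma> a (\<sigma> b x)"
    if "a \<in> carrier A" "b \<in> carrier A" "x \<in> carrier G" for a b x
    using sigma_action[OF AS[OF that(1)] AS[OF that(2)] GS(1)[OF that(3)]] by simp
  show "\<delta> (x \<otimes>\<^bsub>G\<^esub> y) a = \<delta> y (\<delta> x a)"
    if "x \<in> carrier G" "y \<in> carrier G" "a \<in> carrier A" for x y a
    using delta_action[OF that] by simp
  show "\<sigma> a (x \<otimes>\<^bsub>G\<^esub> y) = \<sigma> a x \<otimes>\<^bsub>G\<^esub> \<sigma> (\<delta> x a) y"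
    if "a \<in> carrier A" "x \<in> carrier G" "y \<in> carrier G" for a x y
    using sigma_mult[OF that] by simp
  show "\<delta> x (a \<otimes>\<^bsub>A\<^esub> b) = \<delta> (\<sigma> b x) a \<otimes>\<^bsub>A\<^esub> \<delta> x b"
    if "x \<in> carrier G" "a \<in> carrier A" "b \<in> carrier A" for x a b
    using delta_mult[OF that] by simp
  have sigma_u: "\<sigma> u x = x" if "x \<in> carrier G" for x
    using theta_u GS[OF that] by (simp add: \<sigma>_def)
  have uG: "u \<in> carrier G" using G.one_closed by simp
  have delta_u: "\<delta> u a = a" if "a \<in> carrier A" for a
    using delta_eq[OF that uG] dot_u[OF AS[OF that]] u_circ_A[OF that] by simp
  show "bij_betw (\<sigma> a) (carrier G) (carrier G)" if a: "a \<in> carrier A" for a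
  proof (rule bij_betw_byWitness[where f' = "\<sigma> (inv\<^bsub>A\<^esub> a)"])
    have b: "inv\<^bsub>A\<^esub> a \<in> carrier A" by (rule A.inv_closed[OF a])
    have "inv\<^bsub>A\<^esub> a \<bullet> a = u" "a \<bullet> inv\<^bsub>A\<^esub> a = u"
      using A.l_inv[OF a] A.r_inv[OF a] by simp_all
    then show "\<forall>x\<in>carrier G. \<sigma> (inv\<^bsub>A\<^esub> a) (\<sigma> a x) = x"
      "\<forall>x\<in>carrier G. \<sigma> a (\<sigma> (inv\<^bsub>A\<^esub> a) x) = x"
      using sigma_u AS[OF a] AS[OF b] GS(1) by (metis sigma_action)+
    show "\<sigma> a ` carrier G \<subseteq> carrier G" "\<sigma> (inv\<^bsub>A\<^esub> a) ` carrier G \<subseteq> carrier G"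
      using sigma_closed AS[OF a] AS[OF b] GS(1) by blast+
  qed
  show "bij_betw (\<delta> x) (carrier A) (carrier A)" if x: "x \<in> carrier G" for x
  proof (rule bij_betw_byWitness[where f' = "\<delta> (inv\<^bsub>G\<^esub> x)"])
    have y: "inv\<^bsub>G\<^esub> x \<in> carrier G" by (rule G.inv_closed[OF x])
    have "inv\<^bsub>G\<^esub> x \<cdot> x = u" "x \<cdot> inv\<^bsub>G\<^esub> x = u"
      using G.l_inv[OF x] G.r_inv[OF x] by simp_all
    then show "\<forall>a\<in>carrier A. \<delta> (inv\<^bsub>G\<^esub> x) (\<delta> x a) = a"
      "\<forall>a\<in>carrier A. \<delta> x (\<delta> (inv\<^bsub>G\<^esub> x) a) = a"
      using delta_u delta_action[OF x y] delta_action[OF y x] by metis+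
    show "\<delta> x ` carrier A \<subseteq> carrier A" "\<delta> (inv\<^bsub>G\<^esub> x) ` carrier A \<subseteq> carrier A"
      using delta_closed x y by blast+
  qed
qed

section \<open>Coordinates on \<open>A \<times> G\<close>\<close>

lemma bij_betw_dot: "bij_betw (\<lambda>(a, x). a \<cdot> x) (carrier A \<times> carrier G) S"
proof (rule bij_betw_imageI)
  show "inj_on (\<lambda>(a, x). a \<cdot> x) (carrier A \<times> carrier G)"
  proof (rule inj_onI, clarify)
    fix a x b y
    assume a: "a \<in> carrier A" and x: "x \<in> carrier G" and b: "b \<in> carrier A" and y: "y \<in> carrier G"
      and eq: "a \<cdot> x = b \<cdot> y"
    have aS: "a \<in> S" "a \<cdot> a = a" "b \<in> S" "b \<cdot> b = b" using a b carrier_A by blast+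
    have xS: "x \<in> S" "u \<cdot> x = x" "y \<in> S" "u \<cdot> y = y" using x y carrier_G by blast+
    \<comment> \<open>Left multiplication by \<open>u\<close> removes the idempotent factor; right
      multiplication by the inverse of \<open>x\<close> then recovers \<open>a\<close>.\<close>
    have "u \<cdot> (a \<cdot> x) = x" "u \<cdot> (b \<cdot> y) = y"
      using aS xS u dot_idem[OF aS(1,2) u(1)] dot_idem[OF aS(3,4) u(1)] by (simp_all flip: dot_assoc)
    then have xy: "x = y" using eq by simp
    have xi: "inv\<^bsub>G\<^esub> x \<in> S" "x \<cdot> inv\<^bsub>G\<^esub> x = u"
      using carrier_G[OF G.inv_closed[OF x]] G.r_inv[OF x] by simp_all
    have "a \<cdot> x \<cdot> inv\<^bsub>G\<^esub> x = b \<cdot> x \<cdot> inv\<^bsub>G\<^esub> x" using eq xy by simp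
    then have "a = b" using xi aS xS dot_u by (simp add: dot_assoc)
    then show "a = b \<and> x = y" using xy by simp
  qed
  show "(\<lambda>(a, x). a \<cdot> x) ` (carrier A \<times> carrier G) = S" (is "?m ` _ = S")
  proof (intro subset_antisym subsetI)
    fix p assume p: "p \<in> S"
    then obtain a where a: "a \<in> S" "a \<cdot> a = a" "p = a \<cdot> (u \<cdot> p)"
      using decompose[OF u(1,2)] by blast
    have "a \<in> carrier A" using a carrier_A by blast
    moreover have "u \<cdot> p \<in> carrier G" using p by simp
    ultimately have "?m (a, u \<cdot> p) \<in> ?m ` (carrier A \<times> carrier G)" by (intro imageI SigmaI)
    moreover have "?m (a, u \<cdot> p) = p" using a(3) by (simp only: prod.case)
    ultimately show "p \<in> ?m ` (carrier A \<times> carrier G)" by (simp only:)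
  next
    fix p assume "p \<in> ?m ` (carrier A \<times> carrier G)"
    then obtain a x where "a \<in> carrier A" "x \<in> carrier G" "p = a \<cdot> x"
      by (elim imageE SigmaE) (simp only: prod.case)
    moreover from this have "a \<in> S" "x \<in> S" using carrier_A carrier_G by blast+
    ultimately show "p \<in> S" by simp
  qed
qed

lemma dot_coordinates:
  assumes "a \<in> carrier A" "x \<in> S" "b \<in> carrier A" "y \<in> S"
  shows "(a \<cdot> x) \<cdot> (b \<cdot> y) = a \<cdot> (x \<cdot> y)"
proof -
  have S: "a \<in> S" "b \<in> S" "b \<cdot> b = b" using assms carrier_A by blast+
  have "(a \<cdot> x) \<cdot> (b \<cdot> y) = a \<cdot> (x \<cdot> b \<cdot> y)" using S assms by (simp add: dot_assoc)
  then show ?thesis using dot_idem[OF S(2,3) assms(2)] by simp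
qed

text \<open>As \<open>a \<cdot> x \<cdot> b = a \<cdot> x\<close>, \<open>theta_dot\<close> splits
  off \<open>t = \<theta> (a \<cdot> x) b\<close>, which lies in \<open>A\<close> and solves
  \<open>t \<bullet> \<delta> x a = b\<close>.\<close>

lemma theta_coordinates:
  assumes a: "a \<in> carrier A" and x: "x \<in> carrier G" and b: "b \<in> carrier A" and y: "y \<in> carrier G"
  shows "\<theta> (a \<cdot> x) (b \<cdot> y) = (b \<bullet> inv\<^bsub>A\<^esub> (\<delta> x a)) \<cdot> \<sigma> (\<delta> x a) y"
proof -
  have S: "a \<in> S" "x \<in> S" "b \<in> S" "b \<cdot> b = b" "y \<in> S"
    using a x b y carrier_A carrier_G by blast+
  define d where "d = \<delta> x a"
  have d: "d \<in> carrier A" "d = u \<bullet> (a \<cdot> x)"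
    using delta_closed[OF a x] delta_eq[OF a x] by (simp_all add: d_def)
  have axb: "a \<cdot> x \<cdot> b = a \<cdot> x" using S by (intro dot_idem[OF S(3,4)]) simp
  define t where "t = \<theta> (a \<cdot> x) b"
  have t: "t \<in> carrier A"
    using theta_idem[OF S(3,4), of "a \<cdot> x"] S carrier_A by (simp add: t_def)
  then have tS: "t \<in> S" using carrier_A by blast
  have "t \<bullet> d = b"
    using theta_circ_dot[of "a \<cdot> x" b] S tS axb d by (simp add: t_def circ_u_circ)
  then have "t = b \<bullet> inv\<^bsub>A\<^esub> d"
    using A.inv_solve_right[OF t b d(1)] by simp
  moreover have "\<sigma> d y = u \<cdot> \<theta> (a \<cdot> x) y"
    using sigma_u_circ[of "a \<cdot> x" y] S d by (simp add: \<sigma>_def)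
  moreover have "\<theta> (a \<cdot> x) (b \<cdot> y) = t \<cdot> \<theta> (a \<cdot> x) y"
    using theta_dot[of "a \<cdot> x" b y] S axb by (simp add: t_def)
  ultimately show ?thesis using S tS by (simp add: d_def dot_u_dot)
qed

end

section \<open>From the pentagon equation to the component axioms\<close>

lemma pe_solutionD:
  assumes "pe_solution S s" "x \<in> S" "y \<in> S"
  shows "pe_dot s x y \<in> S" "pe_theta s x y \<in> S"
    and "z \<in> S \<Longrightarrow> pe_dot s (pe_dot s x y) z = pe_dot s x (pe_dot s y z)"
    and "z \<in> S \<Longrightarrow> pe_theta s x (pe_dot s y z) =
      pe_dot s (pe_theta s x y) (pe_theta s (pe_dot s x y) z)"
    and "z \<in> S \<Longrightarrow> pe_theta s (pe_theta s x y) (pe_theta s (pe_dot s x y) z) = pe_theta s y z"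
proof -
  have s: "s p = (pe_dot s (fst p) (snd p), pe_theta s (fst p) (snd p))" for p
    by (simp add: pe_dot_def pe_theta_def)
  have "s (x, y) \<in> S \<times> S" using assms by (auto simp: pe_solution_def)
  then show "pe_dot s x y \<in> S" "pe_theta s x y \<in> S"
    by (simp_all add: pe_dot_def pe_theta_def mem_Times_iff)
  assume "z \<in> S"
  then have "(pe_s23 s \<circ> pe_s13 s \<circ> pe_s12 s) (x, y, z) = (pe_s12 s \<circ> pe_s23 s) (x, y, z)"
    using assms unfolding pe_solution_def by blast
  then show "pe_dot s (pe_dot s x y) z = pe_dot s x (pe_dot s y z)"
    "pe_theta s x (pe_dot s y z) = pe_dot s (pe_theta s x y) (pe_theta s (pe_dot s x y) z)"
    "pe_theta s (pe_theta s x y) (pe_theta s (pe_dot s x y) z) = pe_theta s y z"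
    by (simp_all add: pe_s23_def pe_s13_def pe_s12_def pe_tau12_def pe_dot_def pe_theta_def
        split_beta)
qed

lemma pentagon_pair_of_solution:
  assumes fin: "finite S" and sol: "pe_solution S s" and bij: "pe_bijective S s"
  shows "pentagon_pair S (pe_dot s) (pe_theta s) (pe_circ S s) (pe_psi S s)"
proof -
  let ?d = "pe_dot s" and ?t = "pe_theta s" and ?c = "pe_circ S s" and ?p = "pe_psi S s"
  have inj: "inj_on s (S \<times> S)" and im: "s ` (S \<times> S) = S \<times> S"
    using bij by (auto simp: pe_bijective_def bij_betw_def)
  note D = pe_solutionD[OF sol]
  have closed: "?c y x \<in> S" "?p y x \<in> S" if "x \<in> S" "y \<in> S" for x y
    using inv_into_into[of "(x, y)" s "S \<times> S"] im that
    by (auto simp: pe_circ_def pe_psi_def mem_Times_iff)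
  have right: "?d (?p y x) (?c y x) = x" "?t (?p y x) (?c y x) = y" if "x \<in> S" "y \<in> S" for x y
    using f_inv_into_f[of "(x, y)" s "S \<times> S"] im that
    by (simp_all add: pe_dot_def pe_theta_def pe_circ_def pe_psi_def)
  have left: "?p (?t x y) (?d x y) = x" "?c (?t x y) (?d x y) = y" if "x \<in> S" "y \<in> S" for x y
    using inv_into_f_f[OF inj, of "(x, y)"] that
    by (simp_all add: pe_dot_def pe_theta_def pe_circ_def pe_psi_def)
  have inverse_pentagon:
    "?p r q \<in> S \<and> ?p (?p r q) (?p (?c r q) p) = ?p q p \<and>
      ?c (?p r q) (?p (?c r q) p) = ?p r (?c q p) \<and> ?c (?c r q) p = ?c r (?c q p)"
    if S: "p \<in> S" "q \<in> S" "r \<in> S" for p q r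
  proof -
    \<comment> \<open>\<open>(x, y, z)\<close> is the preimage of \<open>(p, q, r)\<close> under the
      three-fold side of the pentagon equation. The two-fold side therefore sends it to
      \<open>(p, q, r)\<close> too, and inverting that side gives the four identities.\<close>
    define x where "x = ?p (?p r q) (?p (?c r q) p)"
    define y where "y = ?c (?p r q) (?p (?c r q) p)"
    define z where "z = ?c (?c r q) p"
    have xyz: "x \<in> S" "y \<in> S" "z \<in> S" using S by (simp_all add: x_def y_def z_def closed)
    have xy: "?d x y = ?p (?c r q) p" "?t x y = ?p r q"
      using S by (simp_all add: x_def y_def closed right)
    have "?d x (?d y z) = p" "?t x (?d y z) = q" "?t y z = r"
      using D(3-5)[OF xyz(1,2,3)] xy S by (simp_all add: z_def closed right)
    then have "?p q p = x" "?c q p = ?d y z" "?p r (?d y z) = y" "?c r (?d y z) = z"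
      using left[of x "?d y z"] left[of y z] xyz D(1) by simp_all
    then show ?thesis using S by (simp add: x_def y_def z_def closed)
  qed
  show ?thesis
    by unfold_locales (use fin D closed left right inverse_pentagon in auto)
qed

section \<open>Isomorphisms and transport of solutions\<close>

lemma pe_isomorphicE:
  assumes "pe_isomorphic S s T t"
  obtains f where "bij_betw f S T"
    "\<And>x y. \<lbrakk>x \<in> S; y \<in> S\<rbrakk> \<Longrightarrow> t (f x, f y) = map_prod f f (s (x, y))"
  using assms by (force simp: pe_isomorphic_def)

text \<open>The natural bijection \<open>(a, x) \<mapsto> a \<cdot> x\<close> runs into
  \<open>S\<close>, whereas the isomorphism wanted starts there.\<close>

lemma pe_isomorphic_sym:
  assumes iso: "pe_isomorphic S s T t" and s: "s \<in> S \<times> S \<rightarrow> S \<times> S"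
  shows "pe_isomorphic T t S s"
proof -
  obtain f where f: "bij_betw f S T"
    and ts: "\<And>x y. \<lbrakk>x \<in> S; y \<in> S\<rbrakk> \<Longrightarrow> t (f x, f y) = map_prod f f (s (x, y))"
    using pe_isomorphicE[OF iso] by blast
  let ?g = "inv_into S f"
  have g: "?g q \<in> S" "f (?g q) = q" if "q \<in> T" for q
    using that f by (auto simp: bij_betw_def inv_into_into f_inv_into_f)
  have gf: "map_prod ?g ?g (map_prod f f p) = p" if "p \<in> S \<times> S" for p
    using that f by (auto simp: bij_betw_def)
  have "map_prod ?g ?g (t (q, r)) = s (?g q, ?g r)" if "q \<in> T" "r \<in> T" for q r
    using ts[OF g(1)[OF that(1)] g(1)[OF that(2)]] g that gf s by (simp add: Pi_iff)
  then show ?thesis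
    using bij_betw_inv_into[OF f] by (auto simp: pe_isomorphic_def)
qed

text \<open>This gives the pentagon equation on \<open>A \<times> G\<close> without a computation
  from the matched pair axioms.\<close>

lemma pe_solution_transport:
  assumes iso: "pe_isomorphic S s T t" and sol: "pe_solution S s"
  shows "pe_solution T t"
proof -
  obtain f where f: "bij_betw f S T"
    and ts: "\<And>x y. \<lbrakk>x \<in> S; y \<in> S\<rbrakk> \<Longrightarrow> t (f x, f y) = map_prod f f (s (x, y))"
    using pe_isomorphicE[OF iso] by blast
  have T: "T = f ` S" using f by (simp add: bij_betw_def)
  note D = pe_solutionD[OF sol]
  have t: "t (f x, f y) = (f (pe_dot s x y), f (pe_theta s x y))" if "x \<in> S" "y \<in> S" for x y
    using ts[OF that] by (simp add: pe_dot_def pe_theta_def map_prod_def split_beta)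
  show ?thesis
    unfolding pe_solution_def
  proof (intro conjI)
    show "T \<noteq> {}" using sol T by (simp add: pe_solution_def)
    show "t \<in> T \<times> T \<rightarrow> T \<times> T" using T t D(1,2) by auto
    show "\<forall>q\<in>T \<times> T \<times> T. (pe_s23 t \<circ> pe_s13 t \<circ> pe_s12 t) q = (pe_s12 t \<circ> pe_s23 t) q"
      using T t D by (auto simp: pe_s23_def pe_s13_def pe_s12_def pe_tau12_def)
  qed
qed

lemma matched_pair_map_closed:
  assumes "matched_pair A G \<sigma> \<delta>"
  shows "matched_pair_map A G \<sigma> \<delta> \<in>
    (carrier A \<times> carrier G) \<times> (carrier A \<times> carrier G) \<rightarrow> (carrier A \<times> carrier G) \<times> (carrier A \<times> carrier G)"
proof -
  interpret matched_pair A G \<sigma> \<delta> by fact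
  have "\<delta> x a \<in> carrier A" "\<sigma> a x \<in> carrier G" if "a \<in> carrier A" "x \<in> carrier G" for a x
    using delta_bij[OF that(2)] sigma_bij[OF that(1)] that by (auto dest: bij_betwE)
  then show ?thesis by (auto simp: matched_pair_map_def)
qed

section \<open>The matched pair attached to an irretractable solution\<close>

theorem theorem5p4:
  fixes S :: "'a set" and s :: "'a \<times> 'a \<Rightarrow> 'a \<times> 'a" and e0 :: 'a
  defines "u \<equiv> pe_theta s e0 e0"
  defines "A \<equiv> pe_A S s u" and "G \<equiv> pe_G S s u"
    and "\<sigma> \<equiv> pe_sigma s u" and "\<delta> \<equiv> pe_delta S s u"
  assumes "finite S"
    and "pe_solution S s"
    and "pe_bijective S s"
    and "e0 \<in> pe_idem S s"
    and "pe_irretractable S s u"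
  shows "matched_pair A G \<sigma> \<delta>
    \<and> pe_solution (carrier A \<times> carrier G) (matched_pair_map A G \<sigma> \<delta>)
    \<and> pe_isomorphic S s (carrier A \<times> carrier G) (matched_pair_map A G \<sigma> \<delta>)"
proof -
  let ?d = "pe_dot s"
  interpret P: pentagon_pair S ?d "pe_theta s" "pe_circ S s" "pe_psi S s"
    by (rule pentagon_pair_of_solution) fact+
  have e0: "e0 \<in> S" "?d e0 e0 = e0" using \<open>e0 \<in> pe_idem S s\<close> by (simp_all add: pe_idem_def)
  have u: "u \<in> S" "?d u u = u" "pe_circ S s u u = u"
    using e0 P.theta_idem P.theta_idem_circ_idem by (simp_all add: u_def)
  interpret I: irretractable_pair S ?d "pe_theta s" "pe_circ S s" "pe_psi S s" u
  proof
    fix e f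
    assume e: "e \<in> S" "?d e e = e" and f: "f \<in> S" "?d f f = f"
      and eq: "\<And>y. y \<in> S \<Longrightarrow> pe_theta s e y = pe_theta s f y"
    \<comment> \<open>Idempotents have group component \<open>u\<close>, so equal
      \<open>\<theta>\<close> already relates \<open>e\<close> and \<open>f\<close> by
      \<open>pe_retract\<close>.\<close>
    have "?d u u = u" "?d e u = e" "?d f u = f"
      using u P.dot_idem[OF u(1,2)] e f by simp_all
    then have "u \<in> ?d u ` S" "e = ?d e u" "f = ?d f u" using u(1) by force+
    then have "pe_retract S s u e f"
      unfolding pe_retract_def using e f eq by (fastforce simp: pe_idem_def)
    then show "e = f"
      using \<open>pe_irretractable S s u\<close> e f by (simp add: pe_irretractable_def)
  qed (use u in auto)
  have A: "I.A = A" and G: "I.G = G" by (simp_all add: A_def G_def pe_A_def pe_G_def)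
  have \<sigma>: "I.\<sigma> = \<sigma>"
    by (simp add: fun_eq_iff I.\<sigma>_def \<sigma>_def pe_sigma_def)
  have \<delta>: "I.\<delta> = \<delta>"
    by (simp add: fun_eq_iff I.\<delta>_def \<delta>_def pe_delta_def A_def[symmetric] G_def[symmetric]
        flip: A G)
  have mp: "matched_pair A G \<sigma> \<delta>"
    using I.matched_pair_sigma_delta by (simp only: A G \<sigma> \<delta>)
  have "pe_isomorphic (carrier A \<times> carrier G) (matched_pair_map A G \<sigma> \<delta>) S s"
    unfolding pe_isomorphic_def
  proof (intro exI conjI)
    show "bij_betw (\<lambda>(a, x). ?d a x) (carrier A \<times> carrier G) S"
      using I.bij_betw_dot by (simp only: A G)
    show "\<forall>p\<in>(carrier A \<times> carrier G) \<times> (carrier A \<times> carrier G).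
        (map_prod (\<lambda>(a, x). ?d a x) (\<lambda>(a, x). ?d a x) \<circ> matched_pair_map A G \<sigma> \<delta>) p =
        (s \<circ> map_prod (\<lambda>(a, x). ?d a x) (\<lambda>(a, x). ?d a x)) p"
    proof clarify
      fix a x b y
      assume ax: "a \<in> carrier A" "x \<in> carrier G" and b_y: "b \<in> carrier A" "y \<in> carrier G"
      have "x \<in> S" "y \<in> S" using ax b_y I.carrier_G by (simp_all add: G)
      then have "s (?d a x, ?d b y) =
          (?d a (?d x y), ?d (pe_circ S s b (inv\<^bsub>A\<^esub> (\<delta> x a))) (\<sigma> (\<delta> x a) y))"
        using I.dot_coordinates[unfolded A G, of a x b y]
          I.theta_coordinates[unfolded A G \<sigma> \<delta>, OF ax b_y] ax b_y
        by (simp add: pe_dot_def[of s "?d a x"] pe_theta_def[of s "?d a x"] prod_eq_iff)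
      then show "(map_prod (\<lambda>(a, x). ?d a x) (\<lambda>(a, x). ?d a x) \<circ> matched_pair_map A G \<sigma> \<delta>)
          ((a, x), (b, y)) = (s \<circ> map_prod (\<lambda>(a, x). ?d a x) (\<lambda>(a, x). ?d a x)) ((a, x), (b, y))"
        by (simp add: matched_pair_map_def A_def G_def pe_A_def pe_G_def)
    qed
  qed
  moreover have "matched_pair_map A G \<sigma> \<delta> \<in>
      (carrier A \<times> carrier G) \<times> (carrier A \<times> carrier G) \<rightarrow> (carrier A \<times> carrier G) \<times> (carrier A \<times> carrier G)"
    by (rule matched_pair_map_closed[OF mp])
  ultimately have "pe_isomorphic S s (carrier A \<times> carrier G) (matched_pair_map A G \<sigma> \<delta>)"
    by (rule pe_isomorphic_sym)
  then show ?thesis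
    using mp pe_solution_transport \<open>pe_solution S s\<close> by blast
qed

end
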